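(* Let $X=(X_t)_{t\ge 0}$ and $Y=(Y_t)_{t\ge 0}$ be stochastic processes with values in $E=\{e_1,\dots,e_n\}$ and $F=\{f_1,\dots,f_m\}$ respectively. Then $(X,Y)\in\Sigma_S$ and the splitting property holds if and only if $(X,Y)\in\Sigma_P$ and the output property (or the factorization property) holds.
   Context: All random variables live on a probability space $(\Omega,\mathcal{F},P)$. $e_1,\dots,e_n$ are the standard basis vectors of $\mathbb{R}^n$ and $f_1,\dots,f_m$ those of $\mathbb{R}^m$; $\otimes$ is the Kronecker product. Time homogeneity is not assumed. For a process $\zeta$, $\mathcal{F}^\zeta_t=\sigma(\zeta_s: s\le t)$ and $\mathcal{F}^{\zeta+}_t=\sigma(\zeta_s: s\ge t)$. $(X,Y)\in\Sigma_P$ means: for all $t\ge0$ the $\sigma$-algebras $\mathcal{F}^{X+}_{t+1}\vee\mathcal{F}^{Y+}_{t+1}$ and $\mathcal{F}^X_t\vee\mathcal{F}^Y_t$ are conditionally independent given $\sigma(X_t)$. $(X,Y)\in\Sigma_S$ means: for all $t\ge0$ the $\sigma$-algebras $\mathcal{F}^{X+}_{t}\vee\mathcal{F}^{Y+}_{t}$ and $\mathcal{F}^X_{t-1}\vee\mathcal{F}^Y_{t-1}$ are conditionally independent given $\sigma(X_t)$ (with $\mathcal{F}^X_{-1}\vee\mathcal{F}^Y_{-1}$ trivial). Put $\mathcal{F}_t=\sigma\{X_0,\dots,X_t,Y_0,\dots,Y_t\}$ ($\mathcal{F}_{-1}$ trivial), $\mathcal{G}_t=\sigma\{X_0,\dots,X_t,Y_0,\dots,Y_{t-1}\}=\mathcal{F}_{t-1}\vee\sigma(X_t)$,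 $Z_t=Y_t\otimes X_t$ and $W_{t+1}=Y_t\otimes X_{t+1}$. Splitting property: $E[W_{t+1}|\mathcal{G}_t]=E[Y_t|\mathcal{G}_t]\otimes E[X_{t+1}|\mathcal{G}_t]$ for all $t\ge0$. Output property: $E[Y_t|\mathcal{G}_t]=E[Y_t|\sigma(X_t)]$ for all $t\ge0$. Factorization property: for every $t\ge0$ there is a (nonrandom) matrix $K_t\in\mathbb{R}^{m\times n}$ with $E[Z_t|\mathcal{F}_{t-1}]=\Delta(K_t)E[X_t|\mathcal{F}_{t-1}]$; here, for $M\in\mathbb{R}^{m\times n}$ with rows $M_{1\cdot},\dots,M_{m\cdot}$, $\Delta(M)\in\mathbb{R}^{nm\times n}$ is obtained by stacking the $n\times n$ diagonal matrices $\mathrm{diag}(M_{1\cdot}),\dots,\mathrm{diag}(M_{m\cdot})$ one underneath the other. The words "output property (or the factorization property)" mean that the equivalence holds with either of the two properties on the right-hand side. *)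

theory Defs
  imports "HOL-Probability.Probability"
begin

text \<open>
  \<open>\<sigma>(\<zeta>\<^sub>s : s \<in> I)\<close>. Thus \<open>{..t}\<close> gives \<open>\<F>\<^sup>\<zeta>\<^sub>t\<close>, \<open>{t..}\<close> gives \<open>\<F>\<^sup>\<zeta>\<^sup>+\<^sub>t\<close>, \<open>{t}\<close> gives \<open>\<sigma>(\<zeta>\<^sub>t)\<close>, and
  \<open>{..<t}\<close> gives \<open>\<F>\<^sup>\<zeta>\<^bsub>t-1\<^esub>\<close>, which is the trivial \<open>\<sigma>\<close>-algebra for \<open>t = 0\<close>. (An indexed supremum
  of \<open>vimage_algebra\<close>s would have the wrong underlying space for empty \<open>I\<close>.)
\<close>

definition process_sigma ::
    "'a measure \<Rightarrow> (nat \<Rightarrow> 'a \<Rightarrow> 'b::topological_space) \<Rightarrow> nat set \<Rightarrow> 'a measure" where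
  "process_sigma M \<zeta> I = sigma (space M) (\<Union>s\<in>I. {\<zeta> s -` A \<inter> space M |A. A \<in> sets borel})"

definition join_sigma :: "'a measure \<Rightarrow> 'a measure \<Rightarrow> 'a measure" where
  "join_sigma A B = sigma (space A) (sets A \<union> sets B)"

definition joint_sigma ::
    "'a measure \<Rightarrow> (nat \<Rightarrow> 'a \<Rightarrow> 'b::topological_space) \<Rightarrow> (nat \<Rightarrow> 'a \<Rightarrow> 'c::topological_space)
      \<Rightarrow> nat set \<Rightarrow> nat set \<Rightarrow> 'a measure" where
  "joint_sigma M X Y I J = join_sigma (process_sigma M X I) (process_sigma M Y J)"

definition cond_indep_sigma :: "'a measure \<Rightarrow> 'a measure \<Rightarrow> 'a measure \<Rightarrow> 'a measure \<Rightarrow> bool" where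
  "cond_indep_sigma M C A B \<longleftrightarrow>
    (\<forall>a\<in>sets A. \<forall>b\<in>sets B. AE \<omega> in M.
      real_cond_exp M C (indicator (a \<inter> b)) \<omega> =
      real_cond_exp M C (indicator a) \<omega> * real_cond_exp M C (indicator b) \<omega>)"

definition Sigma_P ::
    "'a measure \<Rightarrow> (nat \<Rightarrow> 'a \<Rightarrow> 'b::topological_space) \<Rightarrow> (nat \<Rightarrow> 'a \<Rightarrow> 'c::topological_space) \<Rightarrow> bool" where
  "Sigma_P M X Y \<longleftrightarrow> (\<forall>t. cond_indep_sigma M (process_sigma M X {t})
      (joint_sigma M X Y {t+1..} {t+1..}) (joint_sigma M X Y {..t} {..t}))"

definition Sigma_S ::
    "'a measure \<Rightarrow> (nat \<Rightarrow> 'a \<Rightarrow> 'b::topological_space) \<Rightarrow> (nat \<Rightarrow> 'a \<Rightarrow> 'c::topological_space) \<Rightarrow> bool" where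
  "Sigma_S M X Y \<longleftrightarrow> (\<forall>t. cond_indep_sigma M (process_sigma M X {t})
      (joint_sigma M X Y {t..} {t..}) (joint_sigma M X Y {..<t} {..<t}))"

definition vec_cond_exp :: "'a measure \<Rightarrow> 'a measure \<Rightarrow> ('a \<Rightarrow> real^'k) \<Rightarrow> 'a \<Rightarrow> real^'k" where
  "vec_cond_exp M F V = (\<lambda>\<omega>. \<chi> k. real_cond_exp M F (\<lambda>\<omega>'. V \<omega>' $ k) \<omega>)"

text \<open>
  Vectors in \<open>\<real>\<^bsup>nm\<^esup>\<close> are indexed by pairs: \<open>(j, i)\<close> is the \<open>i\<close>-th entry of the \<open>j\<close>-th block of length
  \<open>n\<close>, both in the Kronecker product and in the rows of the stacked matrix \<open>\<Delta>(K)\<close>.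
\<close>

definition kron :: "real^'m \<Rightarrow> real^'n \<Rightarrow> real^('m::finite \<times> 'n::finite)" where
  "kron y x = (\<chi> p. y $ fst p * x $ snd p)"

definition Delta :: "real^'n^'m \<Rightarrow> real^'n^('m::finite \<times> 'n::finite)" where
  "Delta K = (\<chi> p. \<chi> l. if snd p = l then K $ fst p $ l else 0)"

text \<open>\<open>F_past M X Y t\<close> is \<open>\<F>\<^bsub>t-1\<^esub>\<close>, and \<open>G_sigma M X Y t\<close> is \<open>\<G>\<^sub>t\<close>.\<close>

definition F_past ::
    "'a measure \<Rightarrow> (nat \<Rightarrow> 'a \<Rightarrow> 'b::topological_space) \<Rightarrow> (nat \<Rightarrow> 'a \<Rightarrow> 'c::topological_space) \<Rightarrow> nat \<Rightarrow> 'a measure" where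
  "F_past M X Y t = joint_sigma M X Y {..<t} {..<t}"

definition G_sigma ::
    "'a measure \<Rightarrow> (nat \<Rightarrow> 'a \<Rightarrow> 'b::topological_space) \<Rightarrow> (nat \<Rightarrow> 'a \<Rightarrow> 'c::topological_space) \<Rightarrow> nat \<Rightarrow> 'a measure" where
  "G_sigma M X Y t = joint_sigma M X Y {..t} {..<t}"

definition splitting_property ::
    "'a measure \<Rightarrow> (nat \<Rightarrow> 'a \<Rightarrow> real^'n) \<Rightarrow> (nat \<Rightarrow> 'a \<Rightarrow> real^'m) \<Rightarrow> bool" where
  "splitting_property M X Y \<longleftrightarrow> (\<forall>t. AE \<omega> in M.
      vec_cond_exp M (G_sigma M X Y t) (\<lambda>\<omega>'. kron (Y t \<omega>') (X (t+1) \<omega>')) \<omega> =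
      kron (vec_cond_exp M (G_sigma M X Y t) (Y t) \<omega>) (vec_cond_exp M (G_sigma M X Y t) (X (t+1)) \<omega>))"

definition output_property ::
    "'a measure \<Rightarrow> (nat \<Rightarrow> 'a \<Rightarrow> real^'n) \<Rightarrow> (nat \<Rightarrow> 'a \<Rightarrow> real^'m) \<Rightarrow> bool" where
  "output_property M X Y \<longleftrightarrow> (\<forall>t. AE \<omega> in M.
      vec_cond_exp M (G_sigma M X Y t) (Y t) \<omega> = vec_cond_exp M (process_sigma M X {t}) (Y t) \<omega>)"

definition factorization_property ::
    "'a measure \<Rightarrow> (nat \<Rightarrow> 'a \<Rightarrow> real^'n) \<Rightarrow> (nat \<Rightarrow> 'a \<Rightarrow> real^'m) \<Rightarrow> bool" where
  "factorization_property M X Y \<longleftrightarrow> (\<forall>t. \<exists>K :: real^'n^'m. AE \<omega> in M.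
      vec_cond_exp M (F_past M X Y t) (\<lambda>\<omega>'. kron (Y t \<omega>') (X t \<omega>')) \<omega> =
      Delta K *v vec_cond_exp M (F_past M X Y t) (X t) \<omega>)"

end

theory Submission
  imports Defs
begin

text \<open>
  Since all states are finite in number, each property becomes a family of identities between
  probabilities of events. Write \<open>e = {X\<^sub>t = e\<^sub>k}\<close>, and let \<open>a \<bottom> b | e\<close> mean
  \<open>P(a b e) P(e) = P(a e) P(b e)\<close>. The output property and the factorization property both say
  \<open>{Y\<^sub>t = f\<^sub>j} \<bottom> h | e\<close> for all past events \<open>h \<in> \<F>\<^bsub>t-1\<^esub>\<close>. As soon as
  \<open>{X\<^bsub>t+1\<^esub> = e\<^sub>i} \<bottom> h | e\<close> for these \<open>h\<close>, the splitting property says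
  \<open>{X\<^bsub>t+1\<^esub> = e\<^sub>i} \<bottom> {Y\<^sub>t = f\<^sub>j} \<inter> h | e\<close>. For \<open>\<Sigma>\<^sub>P\<close>, a future event is decoupled from
  \<open>\<F>\<^sub>t\<close> by conditioning on \<open>X\<^bsub>t+1\<^esub>\<close>, whose transition law given \<open>\<F>\<^sub>t\<close> depends on \<open>X\<^sub>t\<close> only;
  for \<open>\<Sigma>\<^sub>S\<close>, one sums over the values of \<open>Y\<^sub>t\<close>.
\<close>

section \<open>Conditional expectations tested against the sets of a sub-sigma-algebra\<close>

context sigma_finite_subalgebra
begin

text \<open>Over sets of \<open>F\<close> a conditional expectation integrates like the function
  itself, and up to null sets it is the only \<open>F\<close>-measurable function that does.\<close>

lemma real_cond_exp_eq_iff: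
  assumes [measurable]: "integrable M f" "integrable M g"
  shows "(AE x in M. real_cond_exp M F f x = real_cond_exp M F g x) \<longleftrightarrow>
    (\<forall>A\<in>sets F. (\<integral>x\<in>A. f x \<partial>M) = (\<integral>x\<in>A. g x \<partial>M))"
proof
  assume ae: "AE x in M. real_cond_exp M F f x = real_cond_exp M F g x"
  show "\<forall>A\<in>sets F. (\<integral>x\<in>A. f x \<partial>M) = (\<integral>x\<in>A. g x \<partial>M)"
  proof
    fix A assume A: "A \<in> sets F"
    have AM[measurable]: "A \<in> sets M" using A subalg by (auto simp: subalgebra_def)
    have "(\<integral>x\<in>A. real_cond_exp M F f x \<partial>M) = (\<integral>x\<in>A. real_cond_exp M F g x \<partial>M)"
      unfolding set_lebesgue_integral_def
      by (rule integral_cong_AE) (use ae in \<open>auto intro!: borel_measurable_cond_exp2\<close>)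
    then show "(\<integral>x\<in>A. f x \<partial>M) = (\<integral>x\<in>A. g x \<partial>M)"
      using real_cond_exp_intA[OF assms(1) A] real_cond_exp_intA[OF assms(2) A] by simp
  qed
next
  assume eq: "\<forall>A\<in>sets F. (\<integral>x\<in>A. f x \<partial>M) = (\<integral>x\<in>A. g x \<partial>M)"
  show "AE x in M. real_cond_exp M F f x = real_cond_exp M F g x"
    by (rule real_cond_exp_charact)
      (use eq assms real_cond_exp_intA[OF assms(2)] real_cond_exp_int(1)[OF assms(2)] in \<open>auto\<close>)
qed

end

context finite_measure_subalgebra
begin

lemma integrable_step:
  fixes d :: "'k::finite \<Rightarrow> real"
  assumes "\<And>k. b k \<in> sets M"
  shows "integrable M (\<lambda>x. \<Sum>k\<in>UNIV. d k * indicator (b k) x)"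
  using assms by (intro Bochner_Integration.integrable_sum integrable_mult_right)
    (auto simp: integrable_indicator_iff emeasure_eq_measure)

text \<open>Turns an a.e. equation into identities between probabilities. The right-hand side is
  conditioned too because the \<open>b k\<close> may lie outside \<open>F\<close>: for the splitting
  property they involve the value of \<open>Y t\<close>, while \<open>F\<close> contains outputs
  only up to \<open>t - 1\<close>.\<close>

lemma real_cond_exp_indicator_eq_step_iff:
  fixes d :: "'k::finite \<Rightarrow> real"
  assumes a: "a \<in> sets M" and b: "\<And>k. b k \<in> sets M"
  shows "(AE x in M. real_cond_exp M F (indicator a) x =
            real_cond_exp M F (\<lambda>x. \<Sum>k\<in>UNIV. d k * indicator (b k) x) x) \<longleftrightarrow>
    (\<forall>A\<in>sets F. measure M (a \<inter> A) = (\<Sum>k\<in>UNIV. d k * measure M (b k \<inter> A)))"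
proof -
  have 1: "(\<integral>x\<in>A. indicator a x \<partial>M) = measure M (a \<inter> A)" if "A \<in> sets F" for A
  proof -
    have "A \<in> sets M" using that subalg by (auto simp: subalgebra_def)
    then show ?thesis using a
      unfolding set_lebesgue_integral_def
      by (simp add: indicator_inter_arith[symmetric] Int_absorb2 Int_commute sets.sets_into_space)
  qed
  have 2: "(\<integral>x\<in>A. (\<Sum>k\<in>UNIV. d k * indicator (b k) x) \<partial>M) = (\<Sum>k\<in>UNIV. d k * measure M (b k \<inter> A))"
    if "A \<in> sets F" for A
  proof -
    have A: "A \<in> sets M" using that subalg by (auto simp: subalgebra_def)
    have "(\<integral>x\<in>A. (\<Sum>k\<in>UNIV. d k * indicator (b k) x) \<partial>M) =
        (\<integral>x. (\<Sum>k\<in>UNIV. d k * indicator (b k \<inter> A) x) \<partial>M)"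
      unfolding set_lebesgue_integral_def
      by (intro Bochner_Integration.integral_cong) (auto simp: sum_distrib_left indicator_def)
    also have "\<dots> = (\<Sum>k\<in>UNIV. d k * measure M (b k \<inter> A))"
      using A b sets.sets_into_space[OF A]
      by (subst Bochner_Integration.integral_sum)
        (auto intro!: sum.cong integrable_mult_right arg_cong[where f = "measure M"]
          simp: integrable_indicator_iff emeasure_eq_measure)
    finally show ?thesis .
  qed
  have "integrable M (indicator a :: _ \<Rightarrow> real)"
    using a by (auto simp: integrable_indicator_iff emeasure_eq_measure)
  then show ?thesis
    using real_cond_exp_eq_iff[OF _ integrable_step[of b d]] b by (simp only: 1 2 cong: ball_cong)
qed

lemma real_cond_exp_step:
  fixes d :: "'k::finite \<Rightarrow> real"
  assumes "\<And>k. b k \<in> sets F"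
  shows "AE x in M. real_cond_exp M F (\<lambda>x. \<Sum>k\<in>UNIV. d k * indicator (b k) x) x =
    (\<Sum>k\<in>UNIV. d k * indicator (b k) x)"
proof (rule real_cond_exp_F_meas)
  show "integrable M (\<lambda>x. \<Sum>k\<in>UNIV. d k * indicator (b k) x)"
    using assms subalg by (intro integrable_step) (auto simp: subalgebra_def)
  show "(\<lambda>x. \<Sum>k\<in>UNIV. d k * indicator (b k) x) \<in> borel_measurable F"
    using assms by measurable
qed

end

section \<open>Traces of the generated sigma-algebras on state events\<close>

text \<open>The sets that agree on \<open>e\<close> with some set of \<open>N\<close> are closed
  under complements and countable unions, so it suffices to inspect generators.\<close>

lemma sigma_sets_trace:
  assumes a: "a \<in> sigma_sets (space N) G" and e: "e \<subseteq> space N"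
    and G: "\<And>g. g \<in> G \<Longrightarrow> \<exists>a'\<in>sets N. g \<inter> e = a' \<inter> e"
  shows "\<exists>a'\<in>sets N. a \<inter> e = a' \<inter> e"
  using a
proof induction
  case (Basic a)
  then show ?case by (rule G)
next
  case Empty
  then show ?case by blast
next
  case (Compl a)
  then obtain a' where "a' \<in> sets N" "a \<inter> e = a' \<inter> e" by blast
  then show ?case using e by (intro bexI[of _ "space N - a'"]) auto
next
  case (Union a)
  then obtain a' where "\<And>n. a' n \<in> sets N \<and> a n \<inter> e = a' n \<inter> e" by metis
  then show ?case by (intro bexI[of _ "\<Union>n. a' n"]) blast+
qed

definition ev :: "'a measure \<Rightarrow> ('a \<Rightarrow> real^'k) \<Rightarrow> 'k \<Rightarrow> 'a set" where
  "ev M Z i = {\<omega> \<in> space M. Z \<omega> = axis i 1}"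

definition preimages :: "'a measure \<Rightarrow> (nat \<Rightarrow> 'a \<Rightarrow> 'b::topological_space) \<Rightarrow> nat set \<Rightarrow> 'a set set" where
  "preimages M Z I = (\<Union>s\<in>I. {Z s -` A \<inter> space M |A. A \<in> sets borel})"

lemma preimages_subset: "preimages M Z I \<subseteq> Pow (space M)"
  by (auto simp: preimages_def)

lemma sets_process_sigma: "sets (process_sigma M Z I) = sigma_sets (space M) (preimages M Z I)"
  using preimages_subset[of M Z I] by (simp add: process_sigma_def preimages_def)

lemma space_process_sigma[simp]: "space (process_sigma M Z I) = space M"
  by (simp add: process_sigma_def space_measure_of_conv)

lemma space_joint_sigma[simp]: "space (joint_sigma M X Y I J) = space M"
  by (simp add: joint_sigma_def join_sigma_def space_measure_of_conv)

lemma sets_joint_sigma: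
  "sets (joint_sigma M X Y I J) = sigma_sets (space M) (preimages M X I \<union> preimages M Y J)"
proof -
  let ?A = "sigma_sets (space M) (preimages M X I)" and ?B = "sigma_sets (space M) (preimages M Y J)"
  have "?A \<union> ?B \<subseteq> Pow (space M)"
    using sigma_sets_into_sp preimages_subset by (metis PowI le_sup_iff subsetI)
  then have "sets (joint_sigma M X Y I J) = sigma_sets (space M) (?A \<union> ?B)"
    by (simp add: joint_sigma_def join_sigma_def sets_process_sigma)
  also have "\<dots> = sigma_sets (space M) (preimages M X I \<union> preimages M Y J)"
  proof (rule sigma_sets_eqI)
    fix a assume "a \<in> ?A \<union> ?B"
    then show "a \<in> sigma_sets (space M) (preimages M X I \<union> preimages M Y J)"
      by (meson UnE Un_upper1 Un_upper2 sigma_sets_mono' subsetD)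
  next
    fix a assume "a \<in> preimages M X I \<union> preimages M Y J"
    then show "a \<in> sigma_sets (space M) (?A \<union> ?B)"
      by (auto intro: sigma_sets.Basic)
  qed
  finally show ?thesis .
qed

lemma joint_sigma_mono:
  assumes "I \<subseteq> I'" "J \<subseteq> J'"
  shows "sets (joint_sigma M X Y I J) \<subseteq> sets (joint_sigma M X Y I' J')"
  unfolding sets_joint_sigma using assms by (intro sigma_sets_mono') (auto simp: preimages_def)

lemma ev_in_preimages: "s \<in> I \<Longrightarrow> ev M (Z s) k \<in> preimages M Z I"
  unfolding preimages_def ev_def by (intro UN_I[of s] CollectI exI[of _ "{axis k 1}"]) auto

lemma ev_in_process_sigma: "s \<in> I \<Longrightarrow> ev M (Z s) k \<in> sets (process_sigma M Z I)"
  unfolding sets_process_sigma by (intro sigma_sets.Basic ev_in_preimages)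

lemma ev_in_joint_sigma:
  "s \<in> I \<Longrightarrow> ev M (X s) k \<in> sets (joint_sigma M X Y I J)"
  "s \<in> J \<Longrightarrow> ev M (Y s) l \<in> sets (joint_sigma M X Y I J)"
  unfolding sets_joint_sigma by (auto intro!: sigma_sets.Basic ev_in_preimages)

text \<open>At a time outside \<open>I\<close> the process is constant on \<open>e\<close>, so a
  preimage at that time contains all of \<open>e\<close> or misses it.\<close>

lemma preimages_trace:
  assumes g: "g \<in> preimages M Z I'" and e: "\<And>s. s \<in> I' - I \<Longrightarrow> \<exists>k. e \<subseteq> ev M (Z s) k"
    and "e \<subseteq> space M"
  shows "g \<in> preimages M Z I \<or> g \<inter> e = {} \<or> g \<inter> e = space M \<inter> e"
proof -
  from g obtain s A where s: "s \<in> I'" "A \<in> sets borel" "g = Z s -` A \<inter> space M"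
    by (auto simp: preimages_def)
  show ?thesis
  proof (cases "s \<in> I")
    case True
    with s show ?thesis by (auto simp: preimages_def)
  next
    case False
    with e s(1) obtain k where "e \<subseteq> ev M (Z s) k" by blast
    then show ?thesis using s(3) \<open>e \<subseteq> space M\<close>
      by (cases "axis k 1 \<in> A") (auto simp: ev_def)
  qed
qed

text \<open>Coordinates frozen on \<open>e\<close> may be dropped from the generators. This carries
  sets of \<open>G_sigma\<close> to \<open>F_past\<close> on a state of \<open>X t\<close>, and
  shifts past and future by one time step on a joint state of \<open>X t\<close> and
  \<open>Y t\<close>.\<close>

lemma joint_sigma_trace:
  assumes a: "a \<in> sets (joint_sigma M X Y I' J')" and e: "e \<subseteq> space M"
    and X: "\<And>s. s \<in> I' - I \<Longrightarrow> \<exists>k. e \<subseteq> ev M (X s) k"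
    and Y: "\<And>s. s \<in> J' - J \<Longrightarrow> \<exists>k. e \<subseteq> ev M (Y s) k"
  shows "\<exists>a'\<in>sets (joint_sigma M X Y I J). a \<inter> e = a' \<inter> e"
proof (rule sigma_sets_trace)
  let ?N = "joint_sigma M X Y I J"
  show "a \<in> sigma_sets (space ?N) (preimages M X I' \<union> preimages M Y J')"
    using a by (simp add: sets_joint_sigma)
  show "e \<subseteq> space ?N" using e by simp
  fix g assume "g \<in> preimages M X I' \<union> preimages M Y J'"
  then have "g \<in> preimages M X I \<union> preimages M Y J \<or> g \<inter> e = {} \<or> g \<inter> e = space M \<inter> e"
    using preimages_trace[where Z = X, OF _ X e] preimages_trace[where Z = Y, OF _ Y e] by (metis Un_iff)
  moreover have "space M \<in> sets ?N" "{} \<in> sets ?N"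
    using sets.top[of ?N] by auto
  ultimately show "\<exists>a'\<in>sets ?N. g \<inter> e = a' \<inter> e"
    by (metis Int_empty_left sets_joint_sigma sigma_sets.Basic)
qed

text \<open>The state events are atoms: once the only coordinate is frozen, just the trivial
  sigma-algebra \<open>?N\<close> remains.\<close>

lemma process_sigma_trace:
  assumes a: "a \<in> sets (process_sigma M Z {t})"
  shows "a \<inter> ev M (Z t) k = {} \<or> a \<inter> ev M (Z t) k = ev M (Z t) k"
proof -
  let ?e = "ev M (Z t) k" and ?N = "sigma (space M) {}"
  have e: "?e \<subseteq> space M" by (auto simp: ev_def)
  have "\<exists>a'\<in>sets ?N. a \<inter> ?e = a' \<inter> ?e"
  proof (rule sigma_sets_trace)
    show "a \<in> sigma_sets (space ?N) (preimages M Z {t})" "?e \<subseteq> space ?N"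
      using a e by (auto simp: sets_process_sigma)
    fix g assume "g \<in> preimages M Z {t}"
    then have "g \<inter> ?e = {} \<or> g \<inter> ?e = space M \<inter> ?e"
      using preimages_trace[of g M Z "{t}" "{}" ?e] e by (auto simp: preimages_def)
    then show "\<exists>a'\<in>sets ?N. g \<inter> ?e = a' \<inter> ?e"
      using sets.top[of ?N] by (metis Int_empty_left sets.empty_sets space_measure_of_conv)
  qed
  then show ?thesis using e by (auto simp: sigma_sets_empty_eq)
qed

section \<open>Conditional independence given an event\<close>

context prob_space
begin

text \<open>The product form avoids division, so the relation holds automatically when
  \<open>e\<close> is null.\<close>

definition indep_on :: "'a set \<Rightarrow> 'a set \<Rightarrow> 'a set \<Rightarrow> bool" where
  "indep_on e a b \<longleftrightarrow> prob (a \<inter> b \<inter> e) * prob e = prob (a \<inter> e) * prob (b \<inter> e)"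

lemma prob_Int_null: "e \<in> events \<Longrightarrow> prob e = 0 \<Longrightarrow> prob (c \<inter> e) = 0"
  using finite_measure_mono[of "c \<inter> e" e] measure_nonneg[of M "c \<inter> e"] by auto

text \<open>For a null \<open>e\<close> both sides of the quotient form are 0, since
  \<open>x / 0 = 0\<close>; hence it can be used without separating that case.\<close>

lemma indep_on_iff:
  assumes "e \<in> events" "a \<in> events" "b \<in> events"
  shows "indep_on e a b \<longleftrightarrow> prob (a \<inter> b \<inter> e) = prob (a \<inter> e) / prob e * prob (b \<inter> e)"
proof (cases "prob e = 0")
  case True
  with assms show ?thesis by (simp add: indep_on_def prob_Int_null)
next
  case False
  then show ?thesis by (simp add: indep_on_def field_simps)
qed

text \<open>If \<open>e\<close> has positive probability, the second premise identifies
  \<open>q\<close> as the conditional probability of \<open>a\<close> given \<open>e\<close>; it is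
  the first premise with \<open>b\<close> the whole space.\<close>

lemma indep_onI:
  assumes "prob (a \<inter> b \<inter> e) = q * prob (b \<inter> e)" "prob (a \<inter> e) = q * prob e"
  shows "indep_on e a b"
  using assms by (simp add: indep_on_def)

lemma indep_on_commute: "indep_on e a b \<longleftrightarrow> indep_on e b a"
  by (simp add: indep_on_def Int_ac mult.commute)

lemma prob_partition_ev:
  assumes Z: "Z \<in> borel_measurable M" "\<And>\<omega>. \<omega> \<in> space M \<Longrightarrow> Z \<omega> \<in> range (\<lambda>i. axis i 1)"
    and a: "a \<in> events"
  shows "prob a = (\<Sum>k\<in>UNIV. prob (a \<inter> ev M Z k))"
proof -
  have [measurable]: "ev M Z k \<in> events" for k
    unfolding ev_def using Z(1) by measurable
  have "disjoint_family (\<lambda>k. a \<inter> ev M Z k)"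
    by (auto simp: disjoint_family_on_def ev_def axis_eq_axis)
  moreover have "a = (\<Union>k. a \<inter> ev M Z k)"
    using Z(2) sets.sets_into_space[OF a] by (fastforce simp: ev_def)
  ultimately show ?thesis using a
    by (subst \<open>a = _\<close>, subst finite_measure_finite_Union) auto
qed

end

section \<open>Conditioning on the current state of X\<close>

locale finite_state_pair = prob_space M for M :: "'a measure" +
  fixes X :: "nat \<Rightarrow> 'a \<Rightarrow> real^'n" and Y :: "nat \<Rightarrow> 'a \<Rightarrow> real^'m"
  assumes X_meas: "X t \<in> borel_measurable M" and Y_meas: "Y t \<in> borel_measurable M"
    and X_range: "\<omega> \<in> space M \<Longrightarrow> X t \<omega> \<in> range (\<lambda>i. axis i 1)"
    and Y_range: "\<omega> \<in> space M \<Longrightarrow> Y t \<omega> \<in> range (\<lambda>j. axis j 1)"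
begin

lemma ev_events[measurable]: "ev M (X t) k \<in> events" "ev M (Y t) j \<in> events"
  unfolding ev_def using X_meas[of t] Y_meas[of t] by measurable

lemmas partition_X = prob_partition_ev[OF X_meas X_range]
  and partition_Y = prob_partition_ev[OF Y_meas Y_range]

lemma subalgebra_joint_sigma: "subalgebra M (joint_sigma M X Y I J)"
  unfolding subalgebra_def sets_joint_sigma
  using measurable_sets[OF X_meas] measurable_sets[OF Y_meas]
  by (auto intro!: sets.sigma_sets_subset simp: preimages_def)

lemma joint_sigma_events: "a \<in> sets (joint_sigma M X Y I J) \<Longrightarrow> a \<in> events"
  using subalgebra_joint_sigma by (auto simp: subalgebra_def)

lemma subalgebra_process_sigma: "subalgebra M (process_sigma M X {t})"
  unfolding subalgebra_def sets_process_sigma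
  using measurable_sets[OF X_meas]
  by (auto intro!: sets.sigma_sets_subset simp: preimages_def)

lemma finite_measure_subalgebra_joint: "finite_measure_subalgebra M (joint_sigma M X Y I J)"
  by (intro finite_measure_subalgebra.intro finite_measure_subalgebra_axioms.intro
    subalgebra_joint_sigma finite_measure_axioms)

lemma finite_measure_subalgebra_process: "finite_measure_subalgebra M (process_sigma M X {t})"
  by (intro finite_measure_subalgebra.intro finite_measure_subalgebra_axioms.intro
    subalgebra_process_sigma finite_measure_axioms)

text \<open>Every set of sigma(X_t) meets each state event in all of it or not at all, so the
  elementary formula has the right integrals. States of probability zero receive the coefficient
  0.\<close>

lemma real_cond_exp_given_X:
  assumes a: "a \<in> events"
  shows "AE \<omega> in M. real_cond_exp M (process_sigma M X {t}) (indicator a) \<omega> =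
    (\<Sum>k\<in>UNIV. prob (a \<inter> ev M (X t) k) / prob (ev M (X t) k) * indicator (ev M (X t) k) \<omega>)"
proof -
  let ?C = "process_sigma M X {t}" and ?e = "ev M (X t)"
  let ?d = "\<lambda>k. prob (a \<inter> ?e k) / prob (?e k)"
  interpret C: finite_measure_subalgebra M ?C by (rule finite_measure_subalgebra_process)
  have eq: "prob (a \<inter> A) = (\<Sum>k\<in>UNIV. ?d k * prob (?e k \<inter> A))" if A: "A \<in> sets ?C" for A
  proof -
    have "A \<in> events" using A C.subalg by (auto simp: subalgebra_def)
    then have "prob (a \<inter> A) = (\<Sum>k\<in>UNIV. prob (a \<inter> A \<inter> ?e k))"
      using a by (intro partition_X) auto
    also have "\<dots> = (\<Sum>k\<in>UNIV. ?d k * prob (?e k \<inter> A))"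
    proof (rule sum.cong[OF refl])
      fix k
      consider "A \<inter> ?e k = {}" | "A \<inter> ?e k = ?e k" using process_sigma_trace[OF A] by blast
      then show "prob (a \<inter> A \<inter> ?e k) = ?d k * prob (?e k \<inter> A)"
      proof cases
        case 1
        then show ?thesis by (simp add: Int_assoc Int_commute[of "?e k"])
      next
        case 2
        then have "a \<inter> A \<inter> ?e k = a \<inter> space M \<inter> ?e k" "?e k \<inter> A = space M \<inter> ?e k"
          using sets.sets_into_space[OF a] by (auto simp: ev_def)
        \<comment> \<open>This trivial instance yields
          \<open>prob (a \<inter> ?e k) = ?d k * prob (?e k)\<close> even when \<open>?e k\<close>
          is null.\<close>
        moreover have "indep_on (?e k) a (space M)"
          using a sets.sets_into_space[OF a] by (simp add: indep_on_def Int_absorb2)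
        ultimately show ?thesis using a by (simp add: indep_on_iff)
      qed
    qed
    finally show ?thesis .
  qed
  have "AE \<omega> in M. real_cond_exp M ?C (indicator a) \<omega> =
      real_cond_exp M ?C (\<lambda>\<omega>. \<Sum>k\<in>UNIV. ?d k * indicator (?e k) \<omega>) \<omega>"
    using eq a by (subst C.real_cond_exp_indicator_eq_step_iff) auto
  moreover have "AE \<omega> in M. real_cond_exp M ?C (\<lambda>\<omega>. \<Sum>k\<in>UNIV. ?d k * indicator (?e k) \<omega>) \<omega> =
      (\<Sum>k\<in>UNIV. ?d k * indicator (?e k) \<omega>)"
    by (rule C.real_cond_exp_step) (auto intro: ev_in_process_sigma)
  ultimately show ?thesis by eventually_elim simp
qed

text \<open>The three conditional probabilities are constant on each state event, so the a.e.
  product rule amounts to one numerical identity per state of positive probability. Null states do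
  not affect the a.e. statement and satisfy \<open>indep_on\<close> trivially.\<close>

lemma cond_indep_given_X_iff:
  assumes "sets A \<subseteq> events" "sets B \<subseteq> events"
  shows "cond_indep_sigma M (process_sigma M X {t}) A B \<longleftrightarrow>
    (\<forall>a\<in>sets A. \<forall>b\<in>sets B. \<forall>k. indep_on (ev M (X t) k) a b)"
  unfolding cond_indep_sigma_def
proof (intro ball_cong refl)
  fix a b assume ab: "a \<in> sets A" "b \<in> sets B"
  let ?C = "process_sigma M X {t}" and ?e = "ev M (X t)"
  have [simp]: "a \<in> events" "b \<in> events" using ab assms by auto
  have step: "(\<Sum>k\<in>UNIV. d k * indicator (?e k) \<omega>) = d l" if "\<omega> \<in> ?e l" for \<omega> l and d :: "'n \<Rightarrow> real"
  proof -
    have ind: "indicator (?e k) \<omega> = (if k = l then 1 else 0 :: real)" for k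
      using that by (auto simp: ev_def axis_eq_axis)
    have "(\<Sum>k\<in>UNIV. d k * indicator (?e k) \<omega>) = (\<Sum>k\<in>UNIV. if k = l then d k else 0)"
      by (intro sum.cong) (simp_all add: ind)
    then show ?thesis by simp
  qed
  \<comment> \<open>The right-hand side of this equivalence no longer depends on \<omega>, so on
    \<open>?e k\<close> the product rule holds almost everywhere or fails almost everywhere.\<close>
  have ae: "AE \<omega> in M. \<forall>k. \<omega> \<in> ?e k \<longrightarrow>
      ((real_cond_exp M ?C (indicator (a \<inter> b)) \<omega> =
        real_cond_exp M ?C (indicator a) \<omega> * real_cond_exp M ?C (indicator b) \<omega>) \<longleftrightarrow>
      prob (a \<inter> b \<inter> ?e k) / prob (?e k) = prob (a \<inter> ?e k) / prob (?e k) * (prob (b \<inter> ?e k) / prob (?e k)))"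
    using real_cond_exp_given_X[OF \<open>a \<in> events\<close>, of t] real_cond_exp_given_X[OF \<open>b \<in> events\<close>, of t]
      real_cond_exp_given_X[OF sets.Int[OF \<open>a \<in> events\<close> \<open>b \<in> events\<close>], of t]
    by eventually_elim (simp only: step simp_thms cong: imp_cong)
  have iff: "indep_on (?e k) a b \<longleftrightarrow> prob (?e k) = 0 \<or>
      prob (a \<inter> b \<inter> ?e k) / prob (?e k) = prob (a \<inter> ?e k) / prob (?e k) * (prob (b \<inter> ?e k) / prob (?e k))" for k
  proof (cases "prob (?e k) = 0")
    case True
    then show ?thesis by (simp add: indep_on_def prob_Int_null ev_events)
  next
    case False
    then show ?thesis by (simp add: indep_on_def field_simps)
  qed
  show "(AE \<omega> in M. real_cond_exp M ?C (indicator (a \<inter> b)) \<omega> =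
        real_cond_exp M ?C (indicator a) \<omega> * real_cond_exp M ?C (indicator b) \<omega>) \<longleftrightarrow>
      (\<forall>k. indep_on (?e k) a b)" (is "?L \<longleftrightarrow> ?R")
  proof
    assume L: ?L
    show ?R
    proof (rule allI, rule ccontr)
      fix k assume n: "\<not> indep_on (?e k) a b"
      \<comment> \<open>A failing identity would force almost every point to avoid
        \<open>?e k\<close>; but on a null state the identity cannot fail.\<close>
      have "AE \<omega> in M. \<omega> \<notin> ?e k"
        using L ae by eventually_elim (use n iff in blast)
      then have "prob (?e k) = 0" by (simp add: AE_iff_measurable[OF _ refl] prob_eq_0)
      with n iff show False by blast
    qed
  next
    assume R: ?R
    have "AE \<omega> in M. prob (?e k) = 0 \<longrightarrow> \<omega> \<notin> ?e k" for k
      by (cases "prob (?e k) = 0") (simp_all add: prob_eq_0)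
    then have "AE \<omega> in M. \<forall>k. prob (?e k) = 0 \<longrightarrow> \<omega> \<notin> ?e k"
      by (intro AE_all_countable[THEN iffD2] allI) 
    with ae AE_space show ?L
    proof eventually_elim
      case (elim \<omega>)
      obtain k where "\<omega> \<in> ?e k" using X_range[OF elim(2), of t] elim(2) by (auto simp: ev_def)
      then show ?case using elim R iff by blast
    qed
  qed
qed

lemma Sigma_S_iff: "Sigma_S M X Y \<longleftrightarrow>
    (\<forall>t. \<forall>a\<in>sets (joint_sigma M X Y {t..} {t..}). \<forall>b\<in>sets (F_past M X Y t).
      \<forall>k. indep_on (ev M (X t) k) a b)"
  unfolding Sigma_S_def F_past_def
  by (subst cond_indep_given_X_iff) (auto dest: joint_sigma_events)

text \<open>The past up to and including \<open>t\<close> appears as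
  \<open>F_past M X Y (Suc t)\<close>, so that both classes are expressed by the same family of
  pasts.\<close>

lemma Sigma_P_iff: "Sigma_P M X Y \<longleftrightarrow>
    (\<forall>t. \<forall>a\<in>sets (joint_sigma M X Y {Suc t..} {Suc t..}). \<forall>b\<in>sets (F_past M X Y (Suc t)).
      \<forall>k. indep_on (ev M (X t) k) a b)"
  unfolding Sigma_P_def F_past_def lessThan_Suc_atMost
  by (subst cond_indep_given_X_iff) (auto dest: joint_sigma_events)

section \<open>Coordinates of the state vectors as indicators\<close>

lemma borel_measurable_vec_nth:
  fixes Z :: "'a \<Rightarrow> real^'k"
  assumes "Z \<in> borel_measurable M"
  shows "(\<lambda>\<omega>. Z \<omega> $ i) \<in> borel_measurable M"
  using assms by (rule measurable_compose)
    (intro borel_measurable_continuous_onI continuous_on_component continuous_on_id)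

lemma real_cond_exp_component:
  assumes "finite_measure_subalgebra M F" and Z: "Z \<in> borel_measurable M"
    and range: "\<And>\<omega>. \<omega> \<in> space M \<Longrightarrow> Z \<omega> \<in> range (\<lambda>i. axis i 1)"
  shows "AE \<omega> in M. real_cond_exp M F (\<lambda>\<omega>. Z \<omega> $ i) \<omega> = real_cond_exp M F (indicator (ev M Z i)) \<omega>"
proof -
  interpret F: finite_measure_subalgebra M F by fact
  have [measurable]: "ev M Z i \<in> events" unfolding ev_def using Z by measurable
  show ?thesis
  proof (rule F.real_cond_exp_cong)
    show "AE \<omega> in M. Z \<omega> $ i = indicator (ev M Z i) \<omega>"
      using range by (intro AE_I2) (fastforce simp: ev_def axis_def indicator_def vec_eq_iff)
    show "(\<lambda>\<omega>. Z \<omega> $ i) \<in> borel_measurable M"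
      using Z by (rule borel_measurable_vec_nth)
  qed simp
qed

lemma real_cond_exp_state_component:
  assumes "finite_measure_subalgebra M F"
  shows "AE \<omega> in M. real_cond_exp M F (\<lambda>\<omega>. X t \<omega> $ i) \<omega> = real_cond_exp M F (indicator (ev M (X t) i)) \<omega>"
    and "AE \<omega> in M. real_cond_exp M F (\<lambda>\<omega>. Y t \<omega> $ j) \<omega> = real_cond_exp M F (indicator (ev M (Y t) j)) \<omega>"
  using assms X_meas X_range Y_meas Y_range by (auto intro!: real_cond_exp_component)

lemma real_cond_exp_kron_component:
  assumes "finite_measure_subalgebra M F"
  shows "AE \<omega> in M. real_cond_exp M F (\<lambda>\<omega>. kron (Y t \<omega>) (X s \<omega>) $ (j, i)) \<omega> =
    real_cond_exp M F (indicator (ev M (Y t) j \<inter> ev M (X s) i)) \<omega>"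
proof -
  interpret F: finite_measure_subalgebra M F by fact
  note [measurable] = X_meas[of s] Y_meas[of t]
  show ?thesis
  proof (rule F.real_cond_exp_cong)
    show "AE \<omega> in M. kron (Y t \<omega>) (X s \<omega>) $ (j, i) = indicator (ev M (Y t) j \<inter> ev M (X s) i) \<omega>"
    proof (rule AE_I2)
      fix \<omega> assume \<omega>: "\<omega> \<in> space M"
      obtain j' i' where "Y t \<omega> = axis j' 1" "X s \<omega> = axis i' 1"
        using X_range[OF \<omega>, of s] Y_range[OF \<omega>, of t] by blast
      with \<omega> show "kron (Y t \<omega>) (X s \<omega>) $ (j, i) = indicator (ev M (Y t) j \<inter> ev M (X s) i) \<omega>"
        by (auto simp: kron_def ev_def axis_eq_axis indicator_def) (auto simp: axis_def)
    qed
    show "(\<lambda>\<omega>. kron (Y t \<omega>) (X s \<omega>) $ (j, i)) \<in> borel_measurable M"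
      unfolding kron_def using borel_measurable_vec_nth[OF X_meas] borel_measurable_vec_nth[OF Y_meas]
      by simp
  qed simp
qed

section \<open>The vector properties as conditional independences\<close>

text \<open>On a fixed state of \<open>X t\<close>, the sets of \<open>G_sigma\<close> have the same
  traces as those of \<open>F_past\<close>, so the sum splits into one identity per state. The set
  \<open>b\<close> is the whole space for the conditional law of a single event, and an output event
  for the splitting property.\<close>

lemma G_step_iff:
  assumes [measurable]: "a \<in> events" "b \<in> events"
  shows "(\<forall>A\<in>sets (G_sigma M X Y t).
      prob (a \<inter> A) = (\<Sum>k\<in>UNIV. d k * prob (ev M (X t) k \<inter> b \<inter> A))) \<longleftrightarrow>
    (\<forall>k. \<forall>h\<in>sets (F_past M X Y t). prob (a \<inter> h \<inter> ev M (X t) k) = d k * prob (b \<inter> h \<inter> ev M (X t) k))"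
    (is "?L \<longleftrightarrow> ?R")
proof
  let ?e = "ev M (X t)"
  assume L: ?L
  show ?R
  proof (intro allI ballI)
    fix k h assume h: "h \<in> sets (F_past M X Y t)"
    moreover have "{..<t} \<subseteq> {..t}" by auto
    \<comment> \<open>Testing with this set isolates the summand of state \<open>k\<close>, because
      different states are disjoint.\<close>
    ultimately have "h \<inter> ?e k \<in> sets (G_sigma M X Y t)"
      using joint_sigma_mono[of "{..<t}" "{..t}" "{..<t}" "{..<t}" M X Y]
      unfolding F_past_def G_sigma_def by (intro sets.Int) (auto intro: ev_in_joint_sigma)
    with L have "prob (a \<inter> h \<inter> ?e k) = (\<Sum>l\<in>UNIV. d l * prob (?e l \<inter> b \<inter> (h \<inter> ?e k)))"
      by (simp add: Int_assoc)
    also have "\<dots> = (\<Sum>l\<in>UNIV. if l = k then d k * prob (b \<inter> h \<inter> ?e k) else 0)"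
    proof (rule sum.cong[OF refl])
      fix l
      have "?e l \<inter> b \<inter> (h \<inter> ?e k) = (if l = k then b \<inter> h \<inter> ?e k else {})"
        by (auto simp: ev_def axis_eq_axis)
      then show "d l * prob (?e l \<inter> b \<inter> (h \<inter> ?e k)) = (if l = k then d k * prob (b \<inter> h \<inter> ?e k) else 0)"
        by simp
    qed
    finally show "prob (a \<inter> h \<inter> ?e k) = d k * prob (b \<inter> h \<inter> ?e k)" by simp
  qed
next
  let ?e = "ev M (X t)"
  assume R: ?R
  show ?L
  proof
    fix A assume A: "A \<in> sets (G_sigma M X Y t)"
    then have [measurable]: "A \<in> events" unfolding G_sigma_def by (rule joint_sigma_events)
    have "prob (a \<inter> A \<inter> ?e k) = d k * prob (?e k \<inter> b \<inter> A)" for k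
    proof -
      obtain h where h: "h \<in> sets (F_past M X Y t)" "A \<inter> ?e k = h \<inter> ?e k"
        using joint_sigma_trace[of A M X Y "{..t}" "{..<t}" "?e k" "{..<t}" "{..<t}"] A
        unfolding G_sigma_def F_past_def by (force simp: ev_def)
      then have "a \<inter> A \<inter> ?e k = a \<inter> h \<inter> ?e k" "?e k \<inter> b \<inter> A = b \<inter> h \<inter> ?e k" by blast+
      with R h show ?thesis by simp
    qed
    then show "prob (a \<inter> A) = (\<Sum>k\<in>UNIV. d k * prob (?e k \<inter> b \<inter> A))"
      using partition_X[of "a \<inter> A" t] by simp
  qed
qed

text \<open>The step function is the conditional probability of \<open>a\<close> given X_t, so the
  left side says that the earlier history adds nothing to X_t in predicting \<open>a\<close>. It
  serves for \<open>a\<close> an event of \<open>Y t\<close> and for \<open>a\<close> an event of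
  \<open>X (Suc t)\<close>.\<close>

lemma real_cond_exp_G_step_iff:
  fixes t
  assumes a: "a \<in> events"
  defines "d \<equiv> \<lambda>k. prob (a \<inter> ev M (X t) k) / prob (ev M (X t) k)"
  shows "(AE \<omega> in M. real_cond_exp M (G_sigma M X Y t) (indicator a) \<omega> =
      (\<Sum>k\<in>UNIV. d k * indicator (ev M (X t) k) \<omega>)) \<longleftrightarrow>
    (\<forall>k. \<forall>h\<in>sets (F_past M X Y t). indep_on (ev M (X t) k) a h)"
proof -
  let ?G = "G_sigma M X Y t" and ?e = "ev M (X t)"
  interpret G: finite_measure_subalgebra M ?G
    unfolding G_sigma_def by (rule finite_measure_subalgebra_joint)
  have step: "AE \<omega> in M. real_cond_exp M ?G (\<lambda>\<omega>. \<Sum>k\<in>UNIV. d k * indicator (?e k) \<omega>) \<omega> =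
      (\<Sum>k\<in>UNIV. d k * indicator (?e k) \<omega>)"
    by (rule G.real_cond_exp_step) (auto simp: G_sigma_def intro: ev_in_joint_sigma)
  have "(AE \<omega> in M. real_cond_exp M ?G (indicator a) \<omega> = (\<Sum>k\<in>UNIV. d k * indicator (?e k) \<omega>)) \<longleftrightarrow>
      (AE \<omega> in M. real_cond_exp M ?G (indicator a) \<omega> =
        real_cond_exp M ?G (\<lambda>\<omega>. \<Sum>k\<in>UNIV. d k * indicator (?e k) \<omega>) \<omega>)"
    by (rule eventually_subst, use step in eventually_elim) simp
  also have "\<dots> \<longleftrightarrow> (\<forall>A\<in>sets ?G. prob (a \<inter> A) = (\<Sum>k\<in>UNIV. d k * prob (?e k \<inter> A)))"
    by (rule G.real_cond_exp_indicator_eq_step_iff) (use a in auto)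
  also have "\<dots> \<longleftrightarrow> (\<forall>A\<in>sets ?G. prob (a \<inter> A) = (\<Sum>k\<in>UNIV. d k * prob (?e k \<inter> space M \<inter> A)))"
    using sets.sets_into_space[OF ev_events(1)] by (simp add: Int_absorb2)
  also have "\<dots> \<longleftrightarrow> (\<forall>k. \<forall>h\<in>sets (F_past M X Y t). prob (a \<inter> h \<inter> ?e k) = d k * prob (space M \<inter> h \<inter> ?e k))"
    by (rule G_step_iff) (use a in auto)
  also have "\<dots> \<longleftrightarrow> (\<forall>k. \<forall>h\<in>sets (F_past M X Y t). indep_on (?e k) a h)"
  proof (intro all_cong1 ball_cong refl)
    fix k h assume "h \<in> sets (F_past M X Y t)"
    then have h: "h \<in> events" unfolding F_past_def by (rule joint_sigma_events)
    then show "(prob (a \<inter> h \<inter> ?e k) = d k * prob (space M \<inter> h \<inter> ?e k)) \<longleftrightarrow> indep_on (?e k) a h"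
      using a sets.sets_into_space[OF h] by (simp add: indep_on_iff d_def Int_absorb1)
  qed
  finally show ?thesis .
qed

text \<open>In each coordinate the conditional expectation given X_t is the step function of
  \<open>real_cond_exp_given_X\<close>, and \<open>real_cond_exp_G_step_iff\<close> applies.\<close>

lemma output_property_iff: "output_property M X Y \<longleftrightarrow>
    (\<forall>t k j. \<forall>h\<in>sets (F_past M X Y t). indep_on (ev M (X t) k) (ev M (Y t) j) h)"
proof -
  have "(AE \<omega> in M. vec_cond_exp M (G_sigma M X Y t) (Y t) \<omega> =
        vec_cond_exp M (process_sigma M X {t}) (Y t) \<omega>) \<longleftrightarrow>
      (\<forall>j k. \<forall>h\<in>sets (F_past M X Y t). indep_on (ev M (X t) k) (ev M (Y t) j) h)" for t
  proof -
    let ?G = "G_sigma M X Y t" and ?C = "process_sigma M X {t}" and ?e = "ev M (X t)"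
    have G: "finite_measure_subalgebra M ?G"
      unfolding G_sigma_def by (rule finite_measure_subalgebra_joint)
    have "(AE \<omega> in M. vec_cond_exp M ?G (Y t) \<omega> = vec_cond_exp M ?C (Y t) \<omega>) \<longleftrightarrow>
      (\<forall>j. AE \<omega> in M. real_cond_exp M ?G (\<lambda>\<omega>. Y t \<omega> $ j) \<omega> = real_cond_exp M ?C (\<lambda>\<omega>. Y t \<omega> $ j) \<omega>)"
      by (simp add: vec_cond_exp_def vec_eq_iff AE_all_countable)
    also have "\<dots> \<longleftrightarrow> (\<forall>j. AE \<omega> in M. real_cond_exp M ?G (indicator (ev M (Y t) j)) \<omega> =
        (\<Sum>k\<in>UNIV. prob (ev M (Y t) j \<inter> ?e k) / prob (?e k) * indicator (?e k) \<omega>))"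
    proof (intro all_cong1 eventually_subst)
      fix j
      show "AE \<omega> in M. (real_cond_exp M ?G (\<lambda>\<omega>. Y t \<omega> $ j) \<omega> = real_cond_exp M ?C (\<lambda>\<omega>. Y t \<omega> $ j) \<omega>) =
         (real_cond_exp M ?G (indicator (ev M (Y t) j)) \<omega> =
        (\<Sum>k\<in>UNIV. prob (ev M (Y t) j \<inter> ?e k) / prob (?e k) * indicator (?e k) \<omega>))"
        using real_cond_exp_state_component(2)[OF G, of t j]
          real_cond_exp_state_component(2)[OF finite_measure_subalgebra_process[of t], of t j]
          real_cond_exp_given_X[OF ev_events(2)[of t j], of t]
        by eventually_elim simp
    qed
    also have "\<dots> \<longleftrightarrow> (\<forall>j k. \<forall>h\<in>sets (F_past M X Y t). indep_on (?e k) (ev M (Y t) j) h)"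
      by (intro all_cong1 real_cond_exp_G_step_iff ev_events)
    finally show ?thesis .
  qed
  then show ?thesis unfolding output_property_def by auto
qed

text \<open>Integrating over past events \<open>h\<close> gives an identity with a constant
  \<open>K $ j $ k\<close> free of \<open>h\<close>. Such a constant exists exactly when the output
  and the past are independent given the state.\<close>

lemma factorization_property_iff: "factorization_property M X Y \<longleftrightarrow>
    (\<forall>t k j. \<forall>h\<in>sets (F_past M X Y t). indep_on (ev M (X t) k) (ev M (Y t) j) h)"
proof -
  have "(AE \<omega> in M. vec_cond_exp M (F_past M X Y t) (\<lambda>\<omega>'. kron (Y t \<omega>') (X t \<omega>')) \<omega> =
        Delta K *v vec_cond_exp M (F_past M X Y t) (X t) \<omega>) \<longleftrightarrow>
      (\<forall>j k. \<forall>h\<in>sets (F_past M X Y t).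
        prob (ev M (Y t) j \<inter> h \<inter> ev M (X t) k) = K $ j $ k * prob (h \<inter> ev M (X t) k))"
    for t and K :: "real^'n^'m"
  proof -
    let ?F = "F_past M X Y t" and ?e = "ev M (X t)"
    have F: "finite_measure_subalgebra M ?F"
      unfolding F_past_def by (rule finite_measure_subalgebra_joint)
    interpret F: finite_measure_subalgebra M ?F by (rule F)
    \<comment> \<open>Each row of \<open>Delta K\<close> has at most one nonzero entry, so the
      matrix equation decouples into scalar ones.\<close>
    have Delta: "(Delta K *v v) $ (j, i) = K $ j $ i * v $ i" for v j i
      by (simp add: Delta_def matrix_vector_mult_def if_distrib[of "\<lambda>x. x * _"] cong: if_cong)
    have "(AE \<omega> in M. vec_cond_exp M ?F (\<lambda>\<omega>'. kron (Y t \<omega>') (X t \<omega>')) \<omega> =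
          Delta K *v vec_cond_exp M ?F (X t) \<omega>) \<longleftrightarrow>
        (\<forall>j i. AE \<omega> in M. real_cond_exp M ?F (\<lambda>\<omega>. kron (Y t \<omega>) (X t \<omega>) $ (j, i)) \<omega> =
          K $ j $ i * real_cond_exp M ?F (\<lambda>\<omega>. X t \<omega> $ i) \<omega>)"
      by (simp add: vec_eq_iff Delta AE_all_countable split_paired_All) (simp add: vec_cond_exp_def)
    \<comment> \<open>The sum over \<open>unit\<close> casts a single scaled indicator as a step
      function.\<close>
    also have "\<dots> \<longleftrightarrow> (\<forall>j i. AE \<omega> in M. real_cond_exp M ?F (indicator (ev M (Y t) j \<inter> ?e i)) \<omega> =
        real_cond_exp M ?F (\<lambda>\<omega>. \<Sum>u::unit\<in>UNIV. K $ j $ i * indicator (?e i) \<omega>) \<omega>)"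
    proof (intro all_cong1 eventually_subst)
      fix j i
      have "AE \<omega> in M. real_cond_exp M ?F (\<lambda>\<omega>. K $ j $ i * indicator (?e i) \<omega>) \<omega> =
          K $ j $ i * real_cond_exp M ?F (indicator (?e i)) \<omega>"
        by (rule F.real_cond_exp_cmult) (simp add: integrable_indicator_iff emeasure_eq_measure)
      then show "AE \<omega> in M. (real_cond_exp M ?F (\<lambda>\<omega>. kron (Y t \<omega>) (X t \<omega>) $ (j, i)) \<omega> =
          K $ j $ i * real_cond_exp M ?F (\<lambda>\<omega>. X t \<omega> $ i) \<omega>) =
          (real_cond_exp M ?F (indicator (ev M (Y t) j \<inter> ?e i)) \<omega> =
        real_cond_exp M ?F (\<lambda>\<omega>. \<Sum>u::unit\<in>UNIV. K $ j $ i * indicator (?e i) \<omega>) \<omega>)"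
        using real_cond_exp_kron_component[OF F, of t t j i]
          real_cond_exp_state_component(1)[OF F, of t i]
        by eventually_elim (simp add: UNIV_unit)
    qed
    also have "\<dots> \<longleftrightarrow> (\<forall>j i. \<forall>h\<in>sets ?F.
        prob (ev M (Y t) j \<inter> ?e i \<inter> h) = (\<Sum>u::unit\<in>UNIV. K $ j $ i * prob (?e i \<inter> h)))"
      by (intro all_cong1 F.real_cond_exp_indicator_eq_step_iff) auto
    finally show ?thesis by (simp add: Int_ac UNIV_unit)
  qed
  then have "factorization_property M X Y \<longleftrightarrow> (\<forall>t. \<exists>K :: real^'n^'m. \<forall>j k. \<forall>h\<in>sets (F_past M X Y t).
      prob (ev M (Y t) j \<inter> h \<inter> ev M (X t) k) = K $ j $ k * prob (h \<inter> ev M (X t) k))"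
    unfolding factorization_property_def by simp
  also have "\<dots> \<longleftrightarrow> (\<forall>t k j. \<forall>h\<in>sets (F_past M X Y t). indep_on (ev M (X t) k) (ev M (Y t) j) h)"
  proof (rule all_cong1, rule iffI)
    fix t
    assume "\<exists>K :: real^'n^'m. \<forall>j k. \<forall>h\<in>sets (F_past M X Y t).
      prob (ev M (Y t) j \<inter> h \<inter> ev M (X t) k) = K $ j $ k * prob (h \<inter> ev M (X t) k)"
    then obtain K :: "real^'n^'m" where K: "\<And>j k h. h \<in> sets (F_past M X Y t) \<Longrightarrow>
      prob (ev M (Y t) j \<inter> h \<inter> ev M (X t) k) = K $ j $ k * prob (h \<inter> ev M (X t) k)" by blast
    \<comment> \<open>Taking the whole space for \<open>h\<close> shows that
      \<open>K $ j $ k\<close> is the conditional probability of the output \<open>j\<close> on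
      every state \<open>k\<close> of positive probability.\<close>
    have "space M \<in> sets (F_past M X Y t)"
      using sets.top[of "F_past M X Y t"] by (simp add: F_past_def)
    from K[OF this] have "prob (ev M (Y t) j \<inter> ev M (X t) k) = K $ j $ k * prob (ev M (X t) k)" for j k
      using sets.sets_into_space[OF ev_events(1)] sets.sets_into_space[OF ev_events(2)]
      by (simp add: Int_absorb1 Int_absorb2)
    with K show "\<forall>k j. \<forall>h\<in>sets (F_past M X Y t). indep_on (ev M (X t) k) (ev M (Y t) j) h"
      by (auto intro: indep_onI)
  next
    fix t
    assume "\<forall>k j. \<forall>h\<in>sets (F_past M X Y t). indep_on (ev M (X t) k) (ev M (Y t) j) h"
    then have "\<forall>k j. \<forall>h\<in>sets (F_past M X Y t). prob (ev M (Y t) j \<inter> h \<inter> ev M (X t) k) =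
        prob (ev M (Y t) j \<inter> ev M (X t) k) / prob (ev M (X t) k) * prob (h \<inter> ev M (X t) k)"
      by (auto simp: indep_on_iff joint_sigma_events F_past_def)
    then show "\<exists>K :: real^'n^'m. \<forall>j k. \<forall>h\<in>sets (F_past M X Y t).
      prob (ev M (Y t) j \<inter> h \<inter> ev M (X t) k) = K $ j $ k * prob (h \<inter> ev M (X t) k)"
      \<comment> \<open>The witness is the matrix of conditional output probabilities, with 0 in the
        columns of null states.\<close>
      by (intro exI[of _ "\<chi> j k. prob (ev M (Y t) j \<inter> ev M (X t) k) / prob (ev M (X t) k)"]) simp
  qed
  finally show ?thesis .
qed

text \<open>
  The hypothesis says that \<open>E[X\<^bsub>t+1\<^esub> | \<G>\<^sub>t]\<close> is a function of \<open>X\<^sub>t\<close>, so that the product on the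
  right-hand side of the splitting property can be pulled inside the conditional expectation.
\<close>

lemma splitting_property_iff:
  assumes H: "\<And>t k i h. h \<in> sets (F_past M X Y t) \<Longrightarrow> indep_on (ev M (X t) k) (ev M (X (Suc t)) i) h"
  shows "splitting_property M X Y \<longleftrightarrow>
    (\<forall>t k i j. \<forall>h\<in>sets (F_past M X Y t).
      indep_on (ev M (X t) k) (ev M (X (Suc t)) i) (ev M (Y t) j \<inter> h))"
proof -
  have "(AE \<omega> in M. vec_cond_exp M (G_sigma M X Y t) (\<lambda>\<omega>'. kron (Y t \<omega>') (X (t+1) \<omega>')) \<omega> =
      kron (vec_cond_exp M (G_sigma M X Y t) (Y t) \<omega>) (vec_cond_exp M (G_sigma M X Y t) (X (t+1)) \<omega>)) \<longleftrightarrow>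
    (\<forall>j i k. \<forall>h\<in>sets (F_past M X Y t).
      indep_on (ev M (X t) k) (ev M (X (Suc t)) i) (ev M (Y t) j \<inter> h))" for t
  proof -
    let ?G = "G_sigma M X Y t" and ?e = "ev M (X t)" and ?f = "ev M (X (Suc t))" and ?y = "ev M (Y t)"
    let ?d = "\<lambda>i k. prob (?f i \<inter> ?e k) / prob (?e k)"
    have G: "finite_measure_subalgebra M ?G"
      unfolding G_sigma_def by (rule finite_measure_subalgebra_joint)
    interpret G: finite_measure_subalgebra M ?G by (rule G)
    have "(AE \<omega> in M. vec_cond_exp M ?G (\<lambda>\<omega>'. kron (Y t \<omega>') (X (t+1) \<omega>')) \<omega> =
        kron (vec_cond_exp M ?G (Y t) \<omega>) (vec_cond_exp M ?G (X (t+1)) \<omega>)) \<longleftrightarrow>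
      (\<forall>j i. AE \<omega> in M. real_cond_exp M ?G (\<lambda>\<omega>. kron (Y t \<omega>) (X (Suc t) \<omega>) $ (j, i)) \<omega> =
          real_cond_exp M ?G (\<lambda>\<omega>. Y t \<omega> $ j) \<omega> * real_cond_exp M ?G (\<lambda>\<omega>. X (Suc t) \<omega> $ i) \<omega>)"
      by (simp add: vec_eq_iff vec_cond_exp_def AE_all_countable split_paired_All)
        (simp add: kron_def)
    also have "\<dots> \<longleftrightarrow> (\<forall>j i. AE \<omega> in M. real_cond_exp M ?G (indicator (?y j \<inter> ?f i)) \<omega> =
        real_cond_exp M ?G (\<lambda>\<omega>. \<Sum>k\<in>UNIV. ?d i k * indicator (?e k \<inter> ?y j) \<omega>) \<omega>)"
    proof (intro all_cong1 eventually_subst)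
      fix j i
      let ?s = "\<lambda>\<omega>. \<Sum>k\<in>UNIV. ?d i k * indicator (?e k) \<omega>"
      have e: "?e k \<in> sets ?G" for k by (auto simp: G_sigma_def intro: ev_in_joint_sigma)
      have prod: "?s \<omega> * indicator (?y j) \<omega> = (\<Sum>k\<in>UNIV. ?d i k * indicator (?e k \<inter> ?y j) \<omega>)" for \<omega>
        by (simp only: sum_distrib_right indicator_inter_arith mult.assoc)
      have "AE \<omega> in M. real_cond_exp M ?G (\<lambda>\<omega>. ?s \<omega> * indicator (?y j) \<omega>) \<omega> =
          ?s \<omega> * real_cond_exp M ?G (indicator (?y j)) \<omega>"
      proof (rule G.real_cond_exp_mult)
        show "?s \<in> borel_measurable ?G" using e by measurable
        show "integrable M (\<lambda>\<omega>. ?s \<omega> * indicator (?y j) \<omega>)"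
          unfolding prod by (rule G.integrable_step) auto
      qed simp
      \<comment> \<open>Here \<open>H\<close> enters: it makes \<open>?s\<close>, which depends on
        \<open>X t\<close> alone, a version of the conditional probability of the next state given
        \<open>?G\<close>.\<close>
      moreover have "AE \<omega> in M. real_cond_exp M ?G (indicator (?f i)) \<omega> = ?s \<omega>"
        using H by (subst real_cond_exp_G_step_iff) auto
      ultimately show "AE \<omega> in M. (real_cond_exp M ?G (\<lambda>\<omega>. kron (Y t \<omega>) (X (Suc t) \<omega>) $ (j, i)) \<omega> =
          real_cond_exp M ?G (\<lambda>\<omega>. Y t \<omega> $ j) \<omega> * real_cond_exp M ?G (\<lambda>\<omega>. X (Suc t) \<omega> $ i) \<omega>) =
        (real_cond_exp M ?G (indicator (?y j \<inter> ?f i)) \<omega> =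
        real_cond_exp M ?G (\<lambda>\<omega>. \<Sum>k\<in>UNIV. ?d i k * indicator (?e k \<inter> ?y j) \<omega>) \<omega>)"
        using real_cond_exp_kron_component[OF G, of t "Suc t" j i]
          real_cond_exp_state_component(1)[OF G, of "Suc t" i]
          real_cond_exp_state_component(2)[OF G, of t j]
        unfolding prod
      proof eventually_elim
        case (elim \<omega>)
        \<comment> \<open>The premises are the five a.e. identities collected above, in their order,
          with the conditional expectations replaced by real variables.\<close>
        have "(c = v * u) = (c' = p)" if "p = r * q" "w = r" "c = c'" "u = w" "v = q"
          for c c' p q r u v w :: real
          using that by (simp add: mult.commute)
        from this[OF elim] show ?case .
      qed
    qed
    also have "\<dots> \<longleftrightarrow> (\<forall>j i. \<forall>A\<in>sets ?G.
        prob (?y j \<inter> ?f i \<inter> A) = (\<Sum>k\<in>UNIV. ?d i k * prob (?e k \<inter> ?y j \<inter> A)))"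
      by (intro all_cong1 G.real_cond_exp_indicator_eq_step_iff) auto
    also have "\<dots> \<longleftrightarrow> (\<forall>j i k. \<forall>h\<in>sets (F_past M X Y t).
        prob (?y j \<inter> ?f i \<inter> h \<inter> ?e k) = ?d i k * prob (?y j \<inter> h \<inter> ?e k))"
      by (intro all_cong1 G_step_iff) auto
    also have "\<dots> \<longleftrightarrow> (\<forall>j i k. \<forall>h\<in>sets (F_past M X Y t). indep_on (?e k) (?f i) (?y j \<inter> h))"
    proof (intro all_cong1 ball_cong refl)
      fix j i k h assume "h \<in> sets (F_past M X Y t)"
      then have [measurable]: "h \<in> events" unfolding F_past_def by (rule joint_sigma_events)
      have "?f i \<inter> (?y j \<inter> h) \<inter> ?e k = ?y j \<inter> ?f i \<inter> h \<inter> ?e k" by blast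
      then show "(prob (?y j \<inter> ?f i \<inter> h \<inter> ?e k) = ?d i k * prob (?y j \<inter> h \<inter> ?e k)) \<longleftrightarrow>
          indep_on (?e k) (?f i) (?y j \<inter> h)"
        by (simp add: indep_on_iff)
    qed
    finally show ?thesis .
  qed
  then show ?thesis unfolding splitting_property_def by auto
qed

section \<open>The implications between the classes\<close>

lemma indep_on_cong:
  assumes "a \<inter> e = a' \<inter> e" "b \<inter> e = b' \<inter> e"
  shows "indep_on e a b \<longleftrightarrow> indep_on e a' b'"
proof -
  have "a \<inter> b \<inter> e = a' \<inter> b' \<inter> e" using assms by blast
  with assms show ?thesis by (simp add: indep_on_def)
qed

text \<open>For fixed \<open>e\<close> and \<open>a\<close>, both sides of the defining identity are
  additive in \<open>b\<close>.\<close>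

lemma indep_on_partition_Y:
  assumes [measurable]: "e \<in> events" "a \<in> events" "b \<in> events"
    and "\<And>j. indep_on e a (b \<inter> ev M (Y t) j)"
  shows "indep_on e a b"
proof -
  have "prob (a \<inter> b \<inter> e) * prob e = (\<Sum>j\<in>UNIV. prob (a \<inter> (b \<inter> ev M (Y t) j) \<inter> e) * prob e)"
    using partition_Y[of "a \<inter> b \<inter> e" t] by (simp add: Int_ac sum_distrib_right)
  also have "\<dots> = (\<Sum>j\<in>UNIV. prob (a \<inter> e) * prob (b \<inter> ev M (Y t) j \<inter> e))"
    using assms(4) by (simp add: indep_on_def)
  also have "\<dots> = prob (a \<inter> e) * prob (b \<inter> e)"
    using partition_Y[of "b \<inter> e" t] by (simp add: Int_ac sum_distrib_left)
  finally show ?thesis by (simp add: indep_on_def)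
qed

text \<open>Passing from \<open>t\<close> to \<open>Suc t\<close> adds only the coordinates
  \<open>X t\<close> and \<open>Y t\<close> to the past, and both are constant on the event
  considered.\<close>

lemma past_trace:
  assumes "h \<in> sets (F_past M X Y (Suc t))"
  shows "\<exists>h'\<in>sets (F_past M X Y t).
    h \<inter> (ev M (Y t) j \<inter> ev M (X t) k) = h' \<inter> (ev M (Y t) j \<inter> ev M (X t) k)"
  unfolding F_past_def
  using assms[unfolded F_past_def]
  by (rule joint_sigma_trace) (auto simp: ev_def less_Suc_eq)

lemma future_trace:
  assumes "a \<in> sets (joint_sigma M X Y {t..} {t..})"
  shows "\<exists>a'\<in>sets (joint_sigma M X Y {Suc t..} {Suc t..}).
    a \<inter> (ev M (Y t) j \<inter> ev M (X t) k) = a' \<inter> (ev M (Y t) j \<inter> ev M (X t) k)"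
  using assms by (rule joint_sigma_trace) (auto simp: ev_def not_less_eq_eq dest: le_antisym)

lemma F_past_mono: "t \<le> t' \<Longrightarrow> sets (F_past M X Y t) \<subseteq> sets (F_past M X Y t')"
  unfolding F_past_def by (intro joint_sigma_mono) auto

lemma F_past_events: "h \<in> sets (F_past M X Y t) \<Longrightarrow> h \<in> events"
  unfolding F_past_def by (rule joint_sigma_events)

text \<open>\<open>Sigma_S\<close> at \<open>t\<close> makes the next state independent of the past
  before \<open>t\<close>; splitting extends this to the past including \<open>Y t\<close>.
  \<open>Sigma_S\<close> at \<open>Suc t\<close> then handles the rest of the future, and the law of
  total probability over the next state joins the two.\<close>

lemma Sigma_P_if_Sigma_S_splitting:
  assumes S: "Sigma_S M X Y" and "splitting_property M X Y"
  shows "Sigma_P M X Y"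
  unfolding Sigma_P_iff
proof (intro allI ballI)
  fix t a h k
  assume a: "a \<in> sets (joint_sigma M X Y {Suc t..} {Suc t..})" and h: "h \<in> sets (F_past M X Y (Suc t))"
  let ?e = "ev M (X t) k" and ?f = "ev M (X (Suc t))"
  note [measurable] = joint_sigma_events[OF a] F_past_events[OF h]
  have "indep_on (ev M (X t) k) (ev M (X (Suc t)) i) h"
    if "h \<in> sets (F_past M X Y t)" for t k i h
  proof -
    have "ev M (X (Suc t)) i \<in> sets (joint_sigma M X Y {t..} {t..})"
      by (rule ev_in_joint_sigma) simp
    with S that show ?thesis unfolding Sigma_S_iff by blast
  qed
  then have split: "indep_on (ev M (X t) k) (?f i) (ev M (Y t) j \<inter> h)"
    if "h \<in> sets (F_past M X Y t)" for k i j h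
    using assms(2) that by (subst (asm) splitting_property_iff) auto
  \<comment> \<open>One-step Markov property: cut \<open>g\<close> along the values of
    \<open>Y t\<close>; on each piece within \<open>?e\<close> it agrees with a past event from
    before \<open>t\<close>.\<close>
  have step: "indep_on ?e (?f i) g" if g: "g \<in> sets (F_past M X Y (Suc t))" for i g
  proof (rule indep_on_partition_Y[where t = t])
    fix j
    obtain g' where g': "g' \<in> sets (F_past M X Y t)"
      "g \<inter> (ev M (Y t) j \<inter> ?e) = g' \<inter> (ev M (Y t) j \<inter> ?e)"
      using past_trace[OF g] by blast
    show "indep_on ?e (?f i) (g \<inter> ev M (Y t) j)"
      using split[OF g'(1), of k i j] g'(2)
      by (subst indep_on_cong[of _ _ "?f i" _ "ev M (Y t) j \<inter> g'"]) blast+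
  qed (use F_past_events[OF g] in auto)
  \<comment> \<open>The Chapman-Kolmogorov expression for the probability of \<open>a\<close> given
    \<open>?e\<close>, summed over the next state; it is 0 if \<open>?e\<close> is null.\<close>
  define q where "q = (\<Sum>i\<in>UNIV. prob (a \<inter> ?f i) / prob (?f i) * (prob (?f i \<inter> ?e) / prob ?e))"
  have *: "prob (a \<inter> g \<inter> ?e) = q * prob (g \<inter> ?e)" if g: "g \<in> sets (F_past M X Y (Suc t))" for g
  proof -
    note [measurable] = F_past_events[OF g]
    \<comment> \<open>The current state is itself past relative to \<open>Suc t\<close>, so
      \<open>Sigma_S\<close> at \<open>Suc t\<close> applies to \<open>g\<close> and
      \<open>?e\<close> together.\<close>
    have ge: "g \<inter> ?e \<in> sets (F_past M X Y (Suc t))"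
      using g unfolding F_past_def by (intro sets.Int) (auto intro: ev_in_joint_sigma)
    have "prob (a \<inter> g \<inter> ?e) = (\<Sum>i\<in>UNIV. prob (a \<inter> (g \<inter> ?e) \<inter> ?f i))"
      using partition_X[of "a \<inter> g \<inter> ?e" "Suc t"] by (simp add: Int_assoc)
    also have "\<dots> = (\<Sum>i\<in>UNIV. prob (a \<inter> ?f i) / prob (?f i) * prob (?f i \<inter> g \<inter> ?e))"
    proof (rule sum.cong[OF refl])
      fix i
      have "indep_on (?f i) a (g \<inter> ?e)" using S a ge unfolding Sigma_S_iff by blast
      moreover have "?f i \<inter> g \<inter> ?e = g \<inter> ?e \<inter> ?f i" by blast
      ultimately show "prob (a \<inter> (g \<inter> ?e) \<inter> ?f i) =
          prob (a \<inter> ?f i) / prob (?f i) * prob (?f i \<inter> g \<inter> ?e)"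
        by (simp add: indep_on_iff)
    qed
    finally have 1: "prob (a \<inter> g \<inter> ?e) = (\<Sum>i\<in>UNIV. prob (a \<inter> ?f i) / prob (?f i) * prob (?f i \<inter> g \<inter> ?e))" .
    have "prob (?f i \<inter> g \<inter> ?e) = prob (?f i \<inter> ?e) / prob ?e * prob (g \<inter> ?e)" for i
      using step[OF g, of i] by (subst (asm) indep_on_iff) auto
    then show ?thesis
      unfolding 1 by (simp only: q_def sum_distrib_right mult.assoc)
  qed
  have "space M \<in> sets (F_past M X Y (Suc t))"
    using sets.top[of "F_past M X Y (Suc t)"] by (simp add: F_past_def)
  from *[OF this] show "indep_on ?e a h"
    using sets.sets_into_space[OF joint_sigma_events[OF a]] sets.sets_into_space[OF ev_events(1)]
    by (intro indep_onI[OF *[OF h]]) (simp add: Int_absorb1 Int_absorb2)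
qed

text \<open>Cut \<open>a\<close> along the values of \<open>Y t\<close>. Each piece is an output
  event intersected with a strictly future event, within the state event. \<open>Sigma_P\<close>
  splits off the future part, the output property separates output and past, and
  \<open>Sigma_P\<close> puts the future part back onto the output.\<close>

lemma Sigma_S_if_Sigma_P_output:
  assumes P: "Sigma_P M X Y" and "output_property M X Y"
  shows "Sigma_S M X Y"
  unfolding Sigma_S_iff
proof (intro allI ballI)
  fix t a h k
  assume a: "a \<in> sets (joint_sigma M X Y {t..} {t..})" and h: "h \<in> sets (F_past M X Y t)"
  let ?e = "ev M (X t) k" and ?y = "ev M (Y t)"
  note [measurable] = joint_sigma_events[OF a] F_past_events[OF h]
  have out: "indep_on ?e (?y j) h" for j
    using assms(2) h unfolding output_property_iff by blast
  have "indep_on ?e h a"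
  proof (rule indep_on_partition_Y[where t = t])
    fix j
    obtain a' where a': "a' \<in> sets (joint_sigma M X Y {Suc t..} {Suc t..})"
      "a \<inter> (?y j \<inter> ?e) = a' \<inter> (?y j \<inter> ?e)"
      using future_trace[OF a] by blast
    note [measurable] = joint_sigma_events[OF a'(1)]
    have y: "?y j \<in> sets (F_past M X Y (Suc t))"
      unfolding F_past_def by (rule ev_in_joint_sigma) simp
    moreover have "h \<in> sets (F_past M X Y (Suc t))" using F_past_mono[of t "Suc t"] h by auto
    \<comment> \<open>The same future event is separated from two past events: with \<open>h\<close>
      to detach the future, without \<open>h\<close> to reattach it.\<close>
    ultimately have "indep_on ?e a' (?y j \<inter> h)" "indep_on ?e a' (?y j)"
      using P a'(1) unfolding Sigma_P_iff by blast+
    then have a'h: "prob (a' \<inter> (?y j \<inter> h) \<inter> ?e) = prob (a' \<inter> ?e) / prob ?e * prob (?y j \<inter> h \<inter> ?e)"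
      and a'y: "prob (a' \<inter> ?y j \<inter> ?e) = prob (a' \<inter> ?e) / prob ?e * prob (?y j \<inter> ?e)"
      by (simp_all add: indep_on_iff)
    \<comment> \<open>The extra factor \<open>prob ?e\<close> produces the product to which the
      output identity \<open>out\<close> applies.\<close>
    have "prob (a' \<inter> ?y j \<inter> h \<inter> ?e) * prob ?e =
        prob (a' \<inter> ?e) / prob ?e * (prob (?y j \<inter> h \<inter> ?e) * prob ?e)"
      using a'h by (simp add: Int_assoc)
    also have "prob (?y j \<inter> h \<inter> ?e) * prob ?e = prob (?y j \<inter> ?e) * prob (h \<inter> ?e)"
      using out[of j] by (simp add: indep_on_def)
    also have "prob (a' \<inter> ?e) / prob ?e * (prob (?y j \<inter> ?e) * prob (h \<inter> ?e)) =
        prob (a' \<inter> ?y j \<inter> ?e) * prob (h \<inter> ?e)"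
      using a'y by simp
    finally have "indep_on ?e (a' \<inter> ?y j) h"
      by (simp add: indep_on_def)
    then have "indep_on ?e (a \<inter> ?y j) h"
      using a'(2) by (subst indep_on_cong[of _ _ "a' \<inter> ?y j" _ h]) blast+
    then show "indep_on ?e h (a \<inter> ?y j)" by (simp add: indep_on_commute)
  qed auto
  then show "indep_on ?e a h" by (simp add: indep_on_commute)
qed

text \<open>Both the hypothesis and the right-hand side of \<open>splitting_property_iff\<close> are
  instances of the independence of the next state from the past including time
  \<open>t\<close>.\<close>

lemma splitting_if_Sigma_P:
  assumes P: "Sigma_P M X Y"
  shows "splitting_property M X Y"
proof -
  have "indep_on (ev M (X t) k) (ev M (X (Suc t)) i) h"
    if "h \<in> sets (F_past M X Y (Suc t))" for t k i h
  proof -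
    have "ev M (X (Suc t)) i \<in> sets (joint_sigma M X Y {Suc t..} {Suc t..})"
      by (rule ev_in_joint_sigma) simp
    with P that show ?thesis unfolding Sigma_P_iff by blast
  qed
  moreover have "h \<in> sets (F_past M X Y (Suc t))" "ev M (Y t) j \<inter> h \<in> sets (F_past M X Y (Suc t))"
    if "h \<in> sets (F_past M X Y t)" for t h j
  proof -
    show "h \<in> sets (F_past M X Y (Suc t))" using F_past_mono[of t "Suc t"] that by auto
    moreover have "ev M (Y t) j \<in> sets (F_past M X Y (Suc t))"
      unfolding F_past_def by (rule ev_in_joint_sigma) simp
    ultimately show "ev M (Y t) j \<inter> h \<in> sets (F_past M X Y (Suc t))" by blast
  qed
  ultimately show ?thesis by (subst splitting_property_iff) auto
qed

text \<open>The future in \<open>Sigma_S\<close> starts at \<open>t\<close> itself, hence contains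
  the events of \<open>Y t\<close>.\<close>

lemma output_if_Sigma_S:
  assumes "Sigma_S M X Y"
  shows "output_property M X Y"
proof -
  have "ev M (Y t) j \<in> sets (joint_sigma M X Y {t..} {t..})" for t j
    by (rule ev_in_joint_sigma) simp
  with assms show ?thesis unfolding output_property_iff Sigma_S_iff by blast
qed

end

theorem proposition4p1:
  fixes M :: "'a measure"
    and X :: "nat \<Rightarrow> 'a \<Rightarrow> real^'n"
    and Y :: "nat \<Rightarrow> 'a \<Rightarrow> real^'m"
  assumes "prob_space M"
    and "\<And>t. X t \<in> borel_measurable M"
    and "\<And>t. Y t \<in> borel_measurable M"
    and "\<And>t \<omega>. \<omega> \<in> space M \<Longrightarrow> X t \<omega> \<in> range (\<lambda>i. axis i 1)"
    and "\<And>t \<omega>. \<omega> \<in> space M \<Longrightarrow> Y t \<omega> \<in> range (\<lambda>j. axis j 1)"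
  shows "(Sigma_S M X Y \<and> splitting_property M X Y \<longleftrightarrow>
            Sigma_P M X Y \<and> output_property M X Y) \<and>
         (Sigma_S M X Y \<and> splitting_property M X Y \<longleftrightarrow>
            Sigma_P M X Y \<and> factorization_property M X Y)"
proof -
  interpret finite_state_pair M X Y
    using assms by (simp add: finite_state_pair_def finite_state_pair_axioms_def)
  have "factorization_property M X Y \<longleftrightarrow> output_property M X Y"
    by (simp only: factorization_property_iff output_property_iff)
  \<comment> \<open>\<open>Sigma_P\<close> already yields splitting and \<open>Sigma_S\<close>
    already yields the output property, so only the two passages between the classes need the
    additional property.\<close>
  then show ?thesis
    using Sigma_P_if_Sigma_S_splitting Sigma_S_if_Sigma_P_output splitting_if_Sigma_P output_if_Sigma_S
    by blast
qed

end
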